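(* Let $n\ge 3$ be an odd integer, let $A\in\mathbb{R}^{n\times n}$ be the tridiagonal matrix with $A_{ii}=2$ for all $i$, $A_{ij}=-1$ for $|i-j|=1$, and all other entries $0$. Let $\mathcal{F}$ be the set of odd integers in $\{1,\dots,n\}$ and $\mathcal{A}$ the set of even integers in $\{1,\dots,n\}$. Let $P_{\mathcal{F}}\in\mathbb{R}^{n\times n}$ be the diagonal matrix with $(P_{\mathcal{F}})_{ii}=1$ for $i\in\mathcal{F}$ and $(P_{\mathcal{F}})_{ii}=0$ for $i\in\mathcal{A}$, and let $M^{-1}:=P_{\mathcal{F}}A^{-1}P_{\mathcal{F}}$. Then $$\kappa_{eff}\left(M^{-1}A\right)=\frac{\left(\kappa(A)+1\right)^2}{4\kappa(A)}.$$
   Context: $\kappa(A)=\lambda_{\max}(A)/\lambda_{\min}(A)$ is the spectral condition number of the symmetric positive definite matrix $A$. The matrix $M^{-1}A$ has real nonnegative eigenvalues, and $\kappa_{eff}(M^{-1}A)$ denotes its effective condition number: the ratio of its largest eigenvalue to its smallest non-zero eigenvalue. The symbol $M^{-1}$ is only a name for the (singular) matrix $P_{\mathcal{F}}A^{-1}P_{\mathcal{F}}$; it is not the inverse of a matrix. *)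

theory Defs
  imports
    "Jordan_Normal_Form.Spectral_Radius"
    "Jordan_Normal_Form.Gauss_Jordan_Elimination"
begin

(* Matrices are indexed from 0: the entry in row i and column j of the mathematical
   n x n matrix is the entry (i - 1, j - 1) here. *)

definition tridiag_mat :: "nat \<Rightarrow> real mat" where
  "tridiag_mat n = mat n n (\<lambda>(i, j).
     if i = j then 2 else if i = Suc j \<or> j = Suc i then - 1 else 0)"

(* The index set F is a subset of {1..n}, hence the shift by Suc. *)
definition coord_proj_mat :: "nat \<Rightarrow> nat set \<Rightarrow> real mat" where
  "coord_proj_mat n F = mat n n (\<lambda>(i, j). if i = j \<and> Suc i \<in> F then 1 else 0)"

definition F_points :: "nat \<Rightarrow> nat set" where
  "F_points n = {i \<in> {1..n}. odd i}"

(* mat_inverse returns an option; it is Some of the inverse exactly for invertible matrices. *)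
definition M_inv :: "nat \<Rightarrow> real mat" where
  "M_inv n = (let P = coord_proj_mat n (F_points n)
              in P * the (mat_inverse (tridiag_mat n)) * P)"

(* Both condition numbers are meant for real square matrices all of whose (complex)
   eigenvalues are real, so that spectrum, which for a real matrix collects the
   real eigenvalues, is the full spectrum (a finite set). *)

definition spectral_cond :: "real mat \<Rightarrow> real" where
  "spectral_cond B = Max (spectrum B) / Min (spectrum B)"

definition effective_cond :: "real mat \<Rightarrow> real" where
  "effective_cond B = Max (spectrum B) / Min (spectrum B - {0})"

end

theory Submission
  imports Defs
begin

text \<open>
  Write \<open>A = 2 - T\<close>, where \<open>T\<close> is the adjacency matrix of a path. The path is bipartite with
  parts \<open>F\<close> and its complement, which for \<open>P = P\<^sub>F\<close> is the identity \<open>PT + TP = T\<close>.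
  Hence \<open>PAPx = 2Px\<close>, and eliminating the complement from \<open>Ay = 2x\<close> turns the eigenvalue
  equation \<open>PCPAx = \<mu>x\<close>, with \<open>C\<close> the inverse of \<open>A\<close> and \<open>\<mu> \<noteq> 0\<close>, into
  \<open>T\<^sup>2x = (4 - 4/\<mu>)x\<close>. So the nonzero eigenvalues are the numbers
  \<open>4/(4 - \<sigma>\<^sup>2)\<close> for the eigenvalues \<open>\<sigma>\<close> of \<open>T\<close>. These are
  \<open>\<sigma> = 2 cos (k\<pi>/(n+1))\<close>; as \<open>n\<close> is odd, \<open>\<sigma> = 0\<close> occurs and gives the smallest nonzero
  eigenvalue \<open>1\<close>. With \<open>c = cos (\<pi>/(n+1))\<close> the largest one is \<open>1/(1 - c\<^sup>2)\<close>, while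
  \<open>\<kappa>(A) = (1 + c)/(1 - c)\<close>.
\<close>

section \<open>Eigenvectors, and square roots of eigenvalues of symmetric squares\<close>

lemma mult_mat_vec_lincomb:
  fixes B :: "'a :: field mat"
  assumes "B \<in> carrier_mat m n" "x \<in> carrier_vec n" "y \<in> carrier_vec n"
  shows "B *\<^sub>v (a \<cdot>\<^sub>v x + b \<cdot>\<^sub>v y) = a \<cdot>\<^sub>v (B *\<^sub>v x) + b \<cdot>\<^sub>v (B *\<^sub>v y)"
  using assms by (simp add: mult_add_distrib_mat_vec[of B m n] mult_mat_vec[of B m n])

lemma scalar_prod_self_nonneg: "0 \<le> v \<bullet> v" for v :: "real vec"
  by (simp add: scalar_prod_def sum_nonneg)

lemma scalar_prod_self_pos:
  fixes v :: "real vec"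
  assumes "v \<in> carrier_vec n" "v \<noteq> 0\<^sub>v n"
  shows "0 < v \<bullet> v"
proof -
  obtain i where i: "i < n" "v $ i \<noteq> 0"
    using assms by (metis carrier_vecD eq_vecI index_zero_vec)
  have "0 < (\<Sum>j\<in>{0..<n}. v $ j * v $ j)"
    by (rule sum_pos2[of _ i]) (use i in \<open>auto simp: zero_less_mult_iff\<close>)
  then show ?thesis using assms by (simp add: scalar_prod_def)
qed

lemma in_spectrumI:
  assumes "B \<in> carrier_mat n n" "v \<in> carrier_vec n" "v \<noteq> 0\<^sub>v n" "B *\<^sub>v v = k \<cdot>\<^sub>v v"
  shows "k \<in> spectrum B"
  using assms by (auto simp: spectrum_def eigenvalue_def eigenvector_def)

lemma in_spectrumE:
  assumes "k \<in> spectrum B" "B \<in> carrier_mat n n"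
  obtains v where "v \<in> carrier_vec n" "v \<noteq> 0\<^sub>v n" "B *\<^sub>v v = k \<cdot>\<^sub>v v"
  using assms by (auto simp: spectrum_def eigenvalue_def eigenvector_def)

text \<open>Undoes the squaring that the elimination leaves behind. Symmetry gives
  \<open>s * (x \<bullet> x)\<close> as the square norm of \<open>T x\<close>, so \<open>s\<close>
  has a real root; which sign of that root is an eigenvalue stays open, and only its square matters
  later.\<close>

lemma symmetric_square_eigenvalue:
  fixes T :: "real mat"
  assumes T: "T \<in> carrier_mat n n" and sym: "transpose_mat T = T"
    and x: "x \<in> carrier_vec n" "x \<noteq> 0\<^sub>v n"
    and TT: "T *\<^sub>v (T *\<^sub>v x) = s \<cdot>\<^sub>v x"
  obtains \<sigma> where "\<sigma> \<in> spectrum T" "\<sigma>\<^sup>2 = s"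
proof -
  have Tx: "T *\<^sub>v x \<in> carrier_vec n" using T x by auto
  have "(T *\<^sub>v x) \<bullet> (T *\<^sub>v x) = x \<bullet> (T *\<^sub>v (T *\<^sub>v x))"
    using transpose_vec_mult_scalar[OF T Tx x(1)] sym by simp
  also have "\<dots> = s * (x \<bullet> x)" using x TT by simp
  finally have "0 \<le> s * (x \<bullet> x)" using scalar_prod_self_nonneg by metis
  then have s: "0 \<le> s" using scalar_prod_self_pos[OF x] by (simp add: zero_le_mult_iff)
  define t where "t = sqrt s"
  have t: "t * t = s" using s by (simp add: t_def)
  \<comment> \<open>The coefficient \<open>1\<close> is written out so that
    \<open>mult_mat_vec_lincomb\<close> applies.\<close>
  define u where "u = t \<cdot>\<^sub>v x + 1 \<cdot>\<^sub>v (T *\<^sub>v x)"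
  have u: "u \<in> carrier_vec n" using x Tx by (simp add: u_def)
  \<comment> \<open>\<open>(T - t)(T + t)x = 0\<close>, so \<open>(T + t)x\<close> is an eigenvector unless it vanishes.\<close>
  have Tu: "T *\<^sub>v u = t \<cdot>\<^sub>v u"
    unfolding u_def mult_mat_vec_lincomb[OF T x(1) Tx] TT
    by (rule eq_vecI) (use x Tx T in \<open>auto simp: t[symmetric] algebra_simps\<close>)
  show ?thesis
  proof (cases "u = 0\<^sub>v n")
    case True
    have "(T *\<^sub>v x) $ i = - t * x $ i" if "i < n" for i
      using arg_cong[OF True, of "\<lambda>w. w $ i"] that x T by (simp add: u_def)
    then have "T *\<^sub>v x = (- t) \<cdot>\<^sub>v x"
      using x T by (intro eq_vecI) auto
    then have "- t \<in> spectrum T" by (rule in_spectrumI[OF T x])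
    then show ?thesis using t by (intro that[of "- t"]) (auto simp: power2_eq_square)
  next
    case False
    then have "t \<in> spectrum T" by (rule in_spectrumI[OF T u _ Tu])
    then show ?thesis using t by (intro that[of t]) (auto simp: power2_eq_square)
  qed
qed

section \<open>Nonzero eigenvalues of the projected product, for an abstract bipartite
  splitting\<close>

context
  fixes n :: nat and A C P T :: "real mat"
  assumes carriers: "A \<in> carrier_mat n n" "C \<in> carrier_mat n n"
      "P \<in> carrier_mat n n" "T \<in> carrier_mat n n"
    and T_sym: "transpose_mat T = T"
    and inverse: "A * C = 1\<^sub>m n" "C * A = 1\<^sub>m n"
    and A_eq: "\<And>x. x \<in> carrier_vec n \<Longrightarrow> A *\<^sub>v x = 2 \<cdot>\<^sub>v x + (- 1) \<cdot>\<^sub>v (T *\<^sub>v x)"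
    and P_idem: "\<And>x. x \<in> carrier_vec n \<Longrightarrow> P *\<^sub>v (P *\<^sub>v x) = P *\<^sub>v x"
    and P_bipartite: "\<And>x. x \<in> carrier_vec n \<Longrightarrow>
      P *\<^sub>v (T *\<^sub>v x) = 1 \<cdot>\<^sub>v (T *\<^sub>v x) + (- 1) \<cdot>\<^sub>v (T *\<^sub>v (P *\<^sub>v x))"
begin

lemma projected_product_apply:
  assumes "x \<in> carrier_vec n"
  shows "(P * C * P * A) *\<^sub>v x = P *\<^sub>v (C *\<^sub>v (P *\<^sub>v (A *\<^sub>v x)))"
proof -
  have "(P * C * P * A) *\<^sub>v x = (P * C * P) *\<^sub>v (A *\<^sub>v x)"
    using carriers assms by (intro assoc_mult_mat_vec) auto
  also have "\<dots> = (P * C) *\<^sub>v (P *\<^sub>v (A *\<^sub>v x))"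
    using carriers assms by (intro assoc_mult_mat_vec) auto
  also have "\<dots> = P *\<^sub>v (C *\<^sub>v (P *\<^sub>v (A *\<^sub>v x)))"
    using carriers assms by (intro assoc_mult_mat_vec) auto
  finally show ?thesis .
qed

text \<open>On the range of \<open>P\<close>, bipartiteness gives
  \<open>P T x = T x - T P x = 0\<close>, so only the diagonal part of \<open>A\<close> survives the
  projection.\<close>

lemma projected_A_apply:
  assumes x: "x \<in> carrier_vec n" and Px: "P *\<^sub>v x = x"
  shows "P *\<^sub>v (A *\<^sub>v x) = 2 \<cdot>\<^sub>v x"
proof -
  have Tx: "T *\<^sub>v x \<in> carrier_vec n" using carriers x by auto
  show ?thesis
    unfolding A_eq[OF x] mult_mat_vec_lincomb[OF carriers(3) x Tx] P_bipartite[OF x] Px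
    by (rule eq_vecI) (use x carriers in auto)
qed

lemma projected_product_nonzero_eigenvalue:
  assumes "\<mu> \<in> spectrum (P * C * P * A)" and \<mu>: "\<mu> \<noteq> 0"
  obtains \<sigma> where "\<sigma> \<in> spectrum T" "\<mu> = 4 / (4 - \<sigma>\<^sup>2)"
proof -
  obtain x where x: "x \<in> carrier_vec n" "x \<noteq> 0\<^sub>v n"
    and ev: "(P * C * P * A) *\<^sub>v x = \<mu> \<cdot>\<^sub>v x"
    using in_spectrumE[OF assms(1)] carriers by (metis mult_carrier_mat)
  have cv: "B *\<^sub>v w \<in> carrier_vec n" if "B \<in> carrier_mat n n" "w \<in> carrier_vec n"
    for B :: "real mat" and w using that by auto
  \<comment> \<open>The vector \<open>\<mu> x\<close> is an image under \<open>P\<close>, hence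
    fixed by it; cancelling \<mu> places \<open>x\<close> itself in the range of
    \<open>P\<close>.\<close>
  have "\<mu> \<cdot>\<^sub>v (P *\<^sub>v x) = P *\<^sub>v (\<mu> \<cdot>\<^sub>v x)"
    using carriers x by (simp add: mult_mat_vec)
  also have "\<dots> = \<mu> \<cdot>\<^sub>v x"
    unfolding ev[symmetric] projected_product_apply[OF x(1)]
    by (intro P_idem cv carriers x)
  finally have e: "\<mu> \<cdot>\<^sub>v (P *\<^sub>v x) = \<mu> \<cdot>\<^sub>v x" .
  have Px: "P *\<^sub>v x = x"
  proof (rule eq_vecI)
    fix i assume "i < dim_vec x"
    then show "(P *\<^sub>v x) $ i = x $ i"
      using arg_cong[OF e, of "\<lambda>w. w $ i"] \<mu> x carriers by simp
  qed (use x carriers in auto)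
  \<comment> \<open>Since \<open>P A x = 2 x\<close>, the eigenvalue equation becomes
    \<open>P y = \<mu> x\<close>, and \<open>C\<close> is traded for the linear system
    \<open>A y = 2 x\<close>.\<close>
  define y where "y = C *\<^sub>v (2 \<cdot>\<^sub>v x)"
  have y: "y \<in> carrier_vec n" unfolding y_def using carriers x by auto
  have Ay: "A *\<^sub>v y = 2 \<cdot>\<^sub>v x"
    unfolding y_def using carriers x inverse
    by (subst assoc_mult_mat_vec[symmetric, of _ n n _ n]) auto
  have Py: "P *\<^sub>v y = \<mu> \<cdot>\<^sub>v x"
    unfolding y_def using ev projected_product_apply[OF x(1)] projected_A_apply[OF x(1) Px] by simp
  have Tx: "T *\<^sub>v x \<in> carrier_vec n" by (intro cv carriers x)
  have Ty: "T *\<^sub>v y \<in> carrier_vec n" by (intro cv carriers y)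
  have TPy: "T *\<^sub>v (P *\<^sub>v y) = \<mu> \<cdot>\<^sub>v (T *\<^sub>v x)"
    unfolding Py using carriers x by (simp add: mult_mat_vec)
  have two_y: "(T *\<^sub>v y) $ i = 2 * y $ i - 2 * x $ i" if "i < n" for i
    using arg_cong[OF Ay, of "\<lambda>w. w $ i"] that x y carriers by (simp add: A_eq[OF y])
  \<comment> \<open>Project \<open>A y = 2 x\<close> and replace \<open>P T y\<close> by
    \<open>T y - T P y\<close>, where \<open>P y\<close> is known.\<close>
  have "2 \<cdot>\<^sub>v (P *\<^sub>v y) + (- 1) \<cdot>\<^sub>v (P *\<^sub>v (T *\<^sub>v y)) = P *\<^sub>v (2 \<cdot>\<^sub>v x)"
    unfolding Ay[symmetric] A_eq[OF y] mult_mat_vec_lincomb[OF carriers(3) y Ty] ..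
  also have "\<dots> = 2 \<cdot>\<^sub>v x" using carriers x Px by (simp add: mult_mat_vec)
  finally have projected: "2 \<cdot>\<^sub>v (\<mu> \<cdot>\<^sub>v x) + (- 1) \<cdot>\<^sub>v
      (1 \<cdot>\<^sub>v (T *\<^sub>v y) + (- 1) \<cdot>\<^sub>v (\<mu> \<cdot>\<^sub>v (T *\<^sub>v x))) = 2 \<cdot>\<^sub>v x"
    unfolding P_bipartite[OF y] TPy unfolding Py .
  have proj: "2 * \<mu> * x $ i - (T *\<^sub>v y) $ i + \<mu> * (T *\<^sub>v x) $ i = 2 * x $ i"
    if "i < n" for i
    using arg_cong[OF projected, of "\<lambda>w. w $ i"] that x y carriers by simp
  \<comment> \<open>Eliminating \<open>T y\<close> between \<open>two_y\<close> and
    \<open>proj\<close> expresses \<open>y\<close> through \<open>x\<close> and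
    \<open>T x\<close>.\<close>
  have y_eq: "y = \<mu> \<cdot>\<^sub>v x + (\<mu> / 2) \<cdot>\<^sub>v (T *\<^sub>v x)"
  proof (rule eq_vecI)
    fix i assume "i < dim_vec (\<mu> \<cdot>\<^sub>v x + (\<mu> / 2) \<cdot>\<^sub>v (T *\<^sub>v x))"
    then have "i < n" using carriers by simp
    then show "y $ i = (\<mu> \<cdot>\<^sub>v x + (\<mu> / 2) \<cdot>\<^sub>v (T *\<^sub>v x)) $ i"
      using proj[of i] two_y[of i] x carriers by simp
  qed (use x y carriers in auto)
  have Ty_eq: "T *\<^sub>v y = \<mu> \<cdot>\<^sub>v (T *\<^sub>v x) + (\<mu> / 2) \<cdot>\<^sub>v (T *\<^sub>v (T *\<^sub>v x))"
    unfolding y_eq mult_mat_vec_lincomb[OF carriers(4) x(1) Tx] ..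
  \<comment> \<open>Two expressions for \<open>T y\<close> are compared: \<open>T\<close> applied to
    \<open>y_eq\<close>, and \<open>T y = 2 (\<mu> - 1) x + \<mu> T x\<close> from
    \<open>proj\<close>. The terms in \<open>T x\<close> cancel.\<close>
  have TT: "T *\<^sub>v (T *\<^sub>v x) = (4 - 4 / \<mu>) \<cdot>\<^sub>v x"
  proof (rule eq_vecI)
    fix i assume "i < dim_vec ((4 - 4 / \<mu>) \<cdot>\<^sub>v x)"
    then have i: "i < n" using x by simp
    have "\<mu> * (T *\<^sub>v x) $ i + \<mu> / 2 * (T *\<^sub>v (T *\<^sub>v x)) $ i = (T *\<^sub>v y) $ i"
      using arg_cong[OF Ty_eq, of "\<lambda>w. w $ i"] i x carriers by simp
    then have "\<mu> * (T *\<^sub>v (T *\<^sub>v x)) $ i = 4 * (\<mu> - 1) * x $ i"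
      using proj[OF i] two_y[OF i] by (simp add: algebra_simps)
    then show "(T *\<^sub>v (T *\<^sub>v x)) $ i = ((4 - 4 / \<mu>) \<cdot>\<^sub>v x) $ i"
      using i x \<mu> by (simp add: field_simps)
  qed (use x carriers in auto)
  obtain \<sigma> where "\<sigma> \<in> spectrum T" "\<sigma>\<^sup>2 = 4 - 4 / \<mu>"
    using symmetric_square_eigenvalue[OF carriers(4) T_sym x TT] .
  then show ?thesis using \<mu> by (intro that[of \<sigma>]) auto
qed

text \<open>With \<open>x = P v\<close>, the map \<open>T\<close> sends \<open>x\<close> to
  \<open>\<sigma> (v - x)\<close> and \<open>v - x\<close> to \<open>\<sigma> x\<close>. The span of
  \<open>x\<close> and \<open>v - x\<close> is thus invariant under \<open>A\<close>, and
  \<open>A y = 2 x\<close> can be solved inside it.\<close>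

lemma projected_product_eigenvalueI:
  assumes v: "v \<in> carrier_vec n" and Tv: "T *\<^sub>v v = \<sigma> \<cdot>\<^sub>v v"
    and Pv: "P *\<^sub>v v \<noteq> 0\<^sub>v n" and \<sigma>: "\<sigma>\<^sup>2 \<noteq> 4"
  shows "4 / (4 - \<sigma>\<^sup>2) \<in> spectrum (P * C * P * A)"
proof -
  define x where "x = P *\<^sub>v v"
  define \<alpha> where "\<alpha> = 2 / (4 - \<sigma>\<^sup>2)"
  have "4 - \<sigma>\<^sup>2 \<noteq> 0" using \<sigma> by simp
  then have \<alpha>: "\<alpha> * (4 - \<sigma>\<^sup>2) = 2" unfolding \<alpha>_def by (rule nonzero_eq_divide_eq[THEN iffD1]) simp
  have x: "x \<in> carrier_vec n" using carriers v by (auto simp: x_def)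
  have Px: "P *\<^sub>v x = x" using P_idem[OF v] by (simp add: x_def)
  have split: "\<sigma> \<cdot>\<^sub>v x = 1 \<cdot>\<^sub>v (\<sigma> \<cdot>\<^sub>v v) + (- 1) \<cdot>\<^sub>v (T *\<^sub>v x)"
    using P_bipartite[OF v] carriers v unfolding Tv x_def by (simp add: mult_mat_vec)
  have Tx: "(T *\<^sub>v x) $ i = \<sigma> * v $ i - \<sigma> * x $ i" if "i < n" for i
    using arg_cong[OF split, of "\<lambda>w. w $ i"] that x v carriers by simp
  \<comment> \<open>This is \<open>2 \<alpha> x + \<alpha> \<sigma> (v - x)\<close>: the ratio of
    the coefficients makes the \<open>v - x\<close> part of \<open>A y\<close> cancel, and \<alpha>
    normalises the rest to \<open>2 x\<close>. The eigenvalue will be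
    \<open>2 \<alpha>\<close>.\<close>
  define y where "y = (2 * \<alpha> - \<alpha> * \<sigma>) \<cdot>\<^sub>v x + (\<alpha> * \<sigma>) \<cdot>\<^sub>v v"
  have y: "y \<in> carrier_vec n" using x v by (simp add: y_def)
  have Ay: "A *\<^sub>v y = 2 \<cdot>\<^sub>v x"
  proof (rule eq_vecI)
    fix i assume "i < dim_vec (2 \<cdot>\<^sub>v x)"
    then have i: "i < n" using x by simp
    have "(A *\<^sub>v y) $ i = 2 * y $ i - (T *\<^sub>v y) $ i"
      using A_eq[OF y] i y carriers by simp
    also have "(T *\<^sub>v y) $ i = (2 * \<alpha> - \<alpha> * \<sigma>) * (T *\<^sub>v x) $ i + \<alpha> * \<sigma> * (\<sigma> * v $ i)"
      unfolding y_def mult_mat_vec_lincomb[OF carriers(4) x v] Tv using i x v carriers by simp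
    also have "2 * y $ i - \<dots> = \<alpha> * (4 - \<sigma>\<^sup>2) * x $ i"
      unfolding Tx[OF i] using i x v by (simp add: y_def algebra_simps power2_eq_square)
    finally show "(A *\<^sub>v y) $ i = (2 \<cdot>\<^sub>v x) $ i" using i x by (simp add: \<alpha>)
  qed (use x carriers in auto)
  have Cx: "C *\<^sub>v (2 \<cdot>\<^sub>v x) = y"
    unfolding Ay[symmetric] using carriers y inverse
    by (subst assoc_mult_mat_vec[symmetric, of _ n n _ n]) auto
  have "P *\<^sub>v y = (2 * \<alpha>) \<cdot>\<^sub>v x"
    unfolding y_def mult_mat_vec_lincomb[OF carriers(3) x v] Px x_def[symmetric]
    by (rule eq_vecI) (use x in \<open>auto simp: algebra_simps\<close>)
  then have "(P * C * P * A) *\<^sub>v x = (4 / (4 - \<sigma>\<^sup>2)) \<cdot>\<^sub>v x"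
    unfolding projected_product_apply[OF x] projected_A_apply[OF x Px] Cx by (simp add: \<alpha>_def)
  then show ?thesis using carriers x Pv
    by (intro in_spectrumI[of _ n x]) (auto simp: x_def)
qed

end

section \<open>Entrywise action of the path, tridiagonal and projection matrices\<close>

definition path_mat :: "nat \<Rightarrow> real mat" where
  "path_mat n = mat n n (\<lambda>(i, j). if i = Suc j \<or> j = Suc i then 1 else 0)"

lemma path_mat_carrier [simp]: "path_mat n \<in> carrier_mat n n"
  by (simp add: path_mat_def)

lemma tridiag_mat_carrier [simp]: "tridiag_mat n \<in> carrier_mat n n"
  by (simp add: tridiag_mat_def)

lemma coord_proj_mat_carrier [simp]: "coord_proj_mat n F \<in> carrier_mat n n"
  by (simp add: coord_proj_mat_def)

lemma transpose_path_mat: "transpose_mat (path_mat n) = path_mat n"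
  by (rule eq_matI) (auto simp: path_mat_def)

lemma path_mat_apply:
  assumes "v \<in> carrier_vec n" "i < n"
  shows "(path_mat n *\<^sub>v v) $ i
    = (if 0 < i then v $ (i - 1) else 0) + (if Suc i < n then v $ Suc i else 0)"
proof -
  have "(path_mat n *\<^sub>v v) $ i = (\<Sum>j = 0..<n. (if i = Suc j \<or> j = Suc i then 1 else 0) * v $ j)"
    using assms by (simp add: path_mat_def scalar_prod_def)
  \<comment> \<open>In row \<open>0\<close> the truncated \<open>i - 1\<close> is \<open>0\<close>
    again, so the guard \<open>0 < i\<close> is what removes the missing left neighbour.\<close>
  also have "\<dots> = (\<Sum>j = 0..<n. (if j = i - 1 then (if 0 < i then v $ j else 0) else 0)
      + (if j = Suc i then v $ j else 0))"
    by (rule sum.cong) auto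
  also have "\<dots> = (if 0 < i then v $ (i - 1) else 0) + (if Suc i < n then v $ Suc i else 0)"
    using assms by (auto simp: sum.distrib sum.delta)
  finally show ?thesis .
qed

lemma tridiag_mat_eq: "tridiag_mat n = 2 \<cdot>\<^sub>m 1\<^sub>m n - path_mat n"
  by (rule eq_matI) (auto simp: path_mat_def tridiag_mat_def)

lemma tridiag_mat_apply:
  assumes v: "v \<in> carrier_vec n"
  shows "tridiag_mat n *\<^sub>v v = 2 \<cdot>\<^sub>v v + (- 1) \<cdot>\<^sub>v (path_mat n *\<^sub>v v)"
proof -
  have "tridiag_mat n *\<^sub>v v = (2 \<cdot>\<^sub>m 1\<^sub>m n) *\<^sub>v v - path_mat n *\<^sub>v v"
    unfolding tridiag_mat_eq using v by (intro minus_mult_distrib_mat_vec) auto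
  also have "(2 \<cdot>\<^sub>m 1\<^sub>m n) *\<^sub>v v = 2 \<cdot>\<^sub>v v"
    using v by (intro eq_vecI) auto
  finally show ?thesis using v carrier_matD(1)[OF path_mat_carrier, of n]
    by (auto intro!: eq_vecI)
qed

lemma coord_proj_mat_apply:
  assumes "v \<in> carrier_vec n" "i < n"
  shows "(coord_proj_mat n F *\<^sub>v v) $ i = (if Suc i \<in> F then v $ i else 0)"
proof -
  have "(coord_proj_mat n F *\<^sub>v v) $ i = (\<Sum>j = 0..<n. (if i = j \<and> Suc i \<in> F then 1 else 0) * v $ j)"
    using assms by (simp add: coord_proj_mat_def scalar_prod_def)
  also have "\<dots> = (\<Sum>j = 0..<n. if j = i then (if Suc i \<in> F then v $ j else 0) else 0)"
    by (rule sum.cong) auto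
  finally
 show ?thesis using assms by simp
qed

section \<open>Spectra of the path and tridiagonal matrices\<close>

definition path_angle :: "nat \<Rightarrow> nat \<Rightarrow> real" where
  "path_angle n k = real k * pi / real (Suc n)"

text \<open>A discrete sine mode. The shift by \<open>Suc\<close> makes entry \<open>i\<close> the
  value at node \<open>i + 1\<close>, with the boundary nodes at \<open>0\<close> and
  \<open>n + 1\<close>, where the sine vanishes.\<close>

definition path_eigenvec :: "nat \<Rightarrow> nat \<Rightarrow> real vec" where
  "path_eigenvec n k = vec n (\<lambda>i. sin (real (Suc i) * path_angle n k))"

lemma path_eigenvec_carrier [simp]: "path_eigenvec n k \<in> carrier_vec n"
  by (simp add: path_eigenvec_def)

lemma path_angle_bounds:
  assumes "k \<in> {1..n}"
  shows "0 < path_angle n k" "path_angle n k < pi"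
proof -
  show "0 < path_angle n k" using assms by (simp add: path_angle_def)
  have "real k * pi < pi * real (Suc n)" using assms by simp
  then show "path_angle n k < pi" by (simp add: path_angle_def pos_divide_less_eq)
qed

lemma cos_path_angle_1_less:
  assumes "1 \<le> n"
  shows "cos (path_angle n 1) < 1"
  using path_angle_bounds[of 1 n] assms cos_monotone_0_pi[of 0 "path_angle n 1"] by simp

text \<open>Entry \<open>0\<close> is mathematical index 1, which belongs to F. One positive entry
  there shows both that the mode is nonzero and that its projection is nonzero.\<close>

lemma path_eigenvec_0_pos:
  assumes "k \<in> {1..n}"
  shows "0 < path_eigenvec n k $ 0"
  using path_angle_bounds[OF assms] assms by (simp add: path_eigenvec_def sin_gt_zero)

text \<open>The sum of two neighbouring sines is \<open>2 cos t\<close> times the middle one. The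
  end rows obey the same identity because the absent neighbours would carry \<open>sin 0\<close> and
  \<open>sin (k \<pi>)\<close>.\<close>

lemma path_mat_eigenvec:
  "path_mat n *\<^sub>v path_eigenvec n k = (2 * cos (path_angle n k)) \<cdot>\<^sub>v path_eigenvec n k"
proof (rule eq_vecI)
  fix i assume "i < dim_vec ((2 * cos (path_angle n k)) \<cdot>\<^sub>v path_eigenvec n k)"
  then have i: "i < n" by (simp add: path_eigenvec_def)
  let ?t = "path_angle n k"
  have left: "(if 0 < i then path_eigenvec n k $ (i - 1) else 0) = sin (real i * ?t)"
    using i by (auto simp: path_eigenvec_def)
  have "real (Suc n) * ?t = real k * pi" by (simp add: path_angle_def)
  then have vanish: "sin (real (Suc n) * ?t) = 0" by (simp only: sin_npi)
  have right: "(if Suc i < n then path_eigenvec n k $ Suc i else 0)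
      = sin (real (Suc (Suc i)) * ?t)"
  proof (cases "Suc i < n")
    case False
    then have "n = Suc i" using i by simp
    with vanish show ?thesis by simp
  qed (simp add: path_eigenvec_def)
  have "sin (real i * ?t) + sin (real (Suc (Suc i)) * ?t) = 2 * cos ?t * sin (real (Suc i) * ?t)"
    using sin_add[of "real (Suc i) * ?t" ?t] sin_diff[of "real (Suc i) * ?t" ?t]
    by (simp add: algebra_simps)
  then show "(path_mat n *\<^sub>v path_eigenvec n k) $ i
      = ((2 * cos ?t) \<cdot>\<^sub>v path_eigenvec n k) $ i"
    unfolding path_mat_apply[OF path_eigenvec_carrier i] left right
    using i by (simp add: path_eigenvec_def)
qed (simp add: path_eigenvec_def path_mat_def)

lemma spectrum_path_mat:
  "spectrum (path_mat n) = (\<lambda>k. 2 * cos (path_angle n k)) ` {1..n}" (is "_ = ?f ` _")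
proof -
  have "inj_on ?f {1..n}"
  proof (rule inj_onI)
    fix k l assume k: "k \<in> {1..n}" and l: "l \<in> {1..n}" and "?f k = ?f l"
    then have "cos (path_angle n k) = cos (path_angle n l)" by simp
    then have "path_angle n k = path_angle n l"
      using path_angle_bounds[OF k] path_angle_bounds[OF l] by (auto intro: cos_inj_pi[OF less_imp_le less_imp_le less_imp_le less_imp_le])
    then show "k = l" by (simp add: path_angle_def)
  qed
  then have "card (?f ` {1..n}) = n" by (simp add: card_image)
  moreover have "?f ` {1..n} \<subseteq> spectrum (path_mat n)"
  proof (rule image_subsetI)
    fix k assume k: "k \<in> {1..n}"
    then have "path_eigenvec n k \<noteq> 0\<^sub>v n"
      using path_eigenvec_0_pos[OF k] k by (auto)
    then show "?f k \<in> spectrum (path_mat n)"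
      by (intro in_spectrumI[OF path_mat_carrier path_eigenvec_carrier _ path_mat_eigenvec])
  qed
  \<comment> \<open>An \<open>n \<times> n\<close> matrix has at most \<open>n\<close> eigenvalues, so the \<open>n\<close> values found are all of them.\<close>
  ultimately show ?thesis
    using card_finite_spectrum[OF path_mat_carrier, of n] by (metis card_seteq)
qed

lemma spectrum_tridiag_mat: "spectrum (tridiag_mat n) = (\<lambda>\<sigma>. 2 - \<sigma>) ` spectrum (path_mat n)"
proof -
  have "tridiag_mat n *\<^sub>v v = (2 - \<sigma>) \<cdot>\<^sub>v v \<longleftrightarrow> path_mat n *\<^sub>v v = \<sigma> \<cdot>\<^sub>v v"
    if v: "v \<in> carrier_vec n" for v \<sigma>
  proof -
    have d: "dim_row (path_mat n) = n" by (simp add: path_mat_def)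
    show ?thesis
      unfolding tridiag_mat_apply[OF v] using v d
      by (auto simp: vec_eq_iff algebra_simps)
  qed
  then have "2 - \<sigma> \<in> spectrum (tridiag_mat n) \<longleftrightarrow> \<sigma> \<in> spectrum (path_mat n)" for \<sigma>
    by (meson in_spectrumE in_spectrumI path_mat_carrier tridiag_mat_carrier)
  from this[of "2 - \<mu>" for \<mu>] this show ?thesis
    by (force simp: image_iff)
qed

text \<open>All angles lie between the first angle and its reflection in \<open>pi / 2\<close>, and
  cosine decreases on \<open>[0, pi]\<close>.\<close>

lemma path_spectrum_bounds:
  assumes "\<sigma> \<in> spectrum (path_mat n)"
  shows "\<bar>\<sigma>\<bar> \<le> 2 * cos (path_angle n 1)"
proof -
  obtain k where k: "k \<in> {1..n}" and \<sigma>: "\<sigma> = 2 * cos (path_angle n k)"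
    using assms by (auto simp: spectrum_path_mat)
  have "path_angle n 1 \<le> path_angle n k"
    using k by (auto simp: path_angle_def intro!: divide_right_mono)
  then have "cos (path_angle n k) \<le> cos (path_angle n 1)"
    using path_angle_bounds[of k n] path_angle_bounds[of 1 n] k by (intro cos_monotone_0_pi_le) auto
  \<comment> \<open>This is \<open>k + 1 \<le> n + 1\<close>; it says that no angle exceeds the last
    one, \<open>pi - path_angle n 1\<close>.\<close>
  moreover have "path_angle n 1 + path_angle n k \<le> pi"
  proof -
    have "(1 + real k) * pi \<le> pi * real (Suc n)" using k by simp
    moreover have "path_angle n 1 + path_angle n k = (1 + real k) * pi / real (Suc n)"
      by (simp add: path_angle_def add_divide_distrib distrib_right)
    ultimately show ?thesis by (simp add: pos_divide_le_eq)
  qed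
  then have "cos (pi - path_angle n 1) \<le> cos (path_angle n k)"
    using path_angle_bounds[of k n] path_angle_bounds[of 1 n] k by (intro cos_monotone_0_pi_le) auto
  ultimately show ?thesis by (simp add: \<sigma>)
qed

lemma path_spectrum_extremes:
  assumes "1 \<le> n"
  shows "2 * cos (path_angle n 1) \<in> spectrum (path_mat n)"
    and "- (2 * cos (path_angle n 1)) \<in> spectrum (path_mat n)"
proof -
  show "2 * cos (path_angle n 1) \<in> spectrum (path_mat n)"
    using assms by (auto simp: spectrum_path_mat)
  have "path_angle n n = pi - path_angle n 1" by (simp add: path_angle_def field_simps)
  then have "2 * cos (path_angle n n) = - (2 * cos (path_angle n 1))" by simp
  then show "- (2 * cos (path_angle n 1)) \<in> spectrum (path_mat n)"
    unfolding spectrum_path_mat using assms by (metis imageI atLeastAtMost_iff order_refl)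
qed

section \<open>Condition number and inverse of the tridiagonal matrix\<close>

lemma spectral_cond_tridiag_mat:
  assumes "1 \<le> n"
  shows "spectral_cond (tridiag_mat n)
    = (1 + cos (path_angle n 1)) / (1 - cos (path_angle n 1))"
proof -
  let ?c = "cos (path_angle n 1)" and ?S = "spectrum (tridiag_mat n)"
  have fin: "finite ?S" by (rule card_finite_spectrum(1)[OF tridiag_mat_carrier])
  \<comment> \<open>The map \<open>2 - \<sigma>\<close> reverses order, so the maximum comes from
    the smallest path eigenvalue and the minimum from the largest.\<close>
  have "Max ?S = 2 + 2 * ?c"
    using path_spectrum_extremes(2)[OF assms] path_spectrum_bounds[of _ n] fin
    unfolding spectrum_tridiag_mat by (intro Max_eqI) force+
  moreover have "Min ?S = 2 - 2 * ?c"
    using path_spectrum_extremes(1)[OF assms] path_spectrum_bounds[of _ n] fin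
    unfolding spectrum_tridiag_mat by (intro Min_eqI) force+
  ultimately have "spectral_cond (tridiag_mat n) = (2 * (1 + ?c)) / (2 * (1 - ?c))"
    by (simp add: spectral_cond_def)
  then show ?thesis by (subst (asm) mult_divide_mult_cancel_left) auto
qed

text \<open>Path eigenvalues are at most \<open>2 * cos (path_angle n 1)\<close>, strictly below 2,
  so 0 is not an eigenvalue of the tridiagonal matrix. This also ensures that \<open>the\<close> is
  applied to a \<open>Some\<close>.\<close>

lemma tridiag_mat_inverse:
  assumes "1 \<le> n"
  shows "tridiag_mat n * the (mat_inverse (tridiag_mat n)) = 1\<^sub>m n"
    and "the (mat_inverse (tridiag_mat n)) * tridiag_mat n = 1\<^sub>m n"
    and "the (mat_inverse (tridiag_mat n)) \<in> carrier_mat n n"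
proof -
  have "0 \<notin> spectrum (tridiag_mat n)"
    using path_spectrum_bounds[of _ n] cos_path_angle_1_less[OF assms] by (force simp: spectrum_tridiag_mat)
  then have "det (tridiag_mat n) \<noteq> 0"
    using det_0_iff_vec_prod_zero_field[OF tridiag_mat_carrier, of n]
      in_spectrumI[OF tridiag_mat_carrier, of _ n 0] by (auto simp: vec_eq_iff)
  then have "tridiag_mat n \<in> Units (ring_mat TYPE(real) n ())"
    by (intro det_non_zero_imp_unit) auto
  then obtain C where "mat_inverse (tridiag_mat n) = Some C"
    using mat_inverse(1)[OF tridiag_mat_carrier, of n "()"] by (cases "mat_inverse (tridiag_mat n)") auto
  with mat_inverse(2)[OF tridiag_mat_carrier this]
  show "tridiag_mat n * the (mat_inverse (tridiag_mat n)) = 1\<^sub>m n"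
    and "the (mat_inverse (tridiag_mat n)) * tridiag_mat n = 1\<^sub>m n"
    and "the (mat_inverse (tridiag_mat n)) \<in> carrier_mat n n" by auto
qed

section \<open>The projected product for the path\<close>

lemma coord_proj_mat_idem:
  assumes "x \<in> carrier_vec n"
  shows "coord_proj_mat n F *\<^sub>v (coord_proj_mat n F *\<^sub>v x) = coord_proj_mat n F *\<^sub>v x"
proof -
  have "coord_proj_mat n F *\<^sub>v x \<in> carrier_vec n"
    using assms by (intro mult_mat_vec_carrier[of _ n n]) auto
  then show ?thesis
    using assms carrier_matD(1)[OF coord_proj_mat_carrier, of n F]
    by (intro eq_vecI) (auto simp: coord_proj_mat_apply simp del: index_mult_mat_vec)
qed

text \<open>Neighbours have opposite parity: an entry of \<open>T x\<close> at a point of F draws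
  only on entries outside F, and conversely. Hence \<open>P T = T (1 - P)\<close>.\<close>

lemma coord_proj_path_bipartite:
  assumes x: "x \<in> carrier_vec n"
  shows "coord_proj_mat n (F_points n) *\<^sub>v (path_mat n *\<^sub>v x) = 1 \<cdot>\<^sub>v (path_mat n *\<^sub>v x)
    + (- 1) \<cdot>\<^sub>v (path_mat n *\<^sub>v (coord_proj_mat n (F_points n) *\<^sub>v x))" (is "?P *\<^sub>v _ = _")
proof (rule eq_vecI)
  have Px: "?P *\<^sub>v x \<in> carrier_vec n" and Tx: "path_mat n *\<^sub>v x \<in> carrier_vec n"
    using x by (auto intro!: mult_mat_vec_carrier[of _ n n])
  \<comment> \<open>Odd mathematical indices are the even matrix indices.\<close>
  have odd_points: "Suc j \<in> F_points n \<longleftrightarrow> even j" if "j < n" for j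
    using that by (simp add: F_points_def)
  have d: "dim_row (path_mat n) = n" "dim_row ?P = n"
    by (auto simp: path_mat_def coord_proj_mat_def)
  fix i assume "i < dim_vec (1 \<cdot>\<^sub>v (path_mat n *\<^sub>v x) + (- 1) \<cdot>\<^sub>v (path_mat n *\<^sub>v (?P *\<^sub>v x)))"
  then have i: "i < n" using d by simp
  show "(?P *\<^sub>v (path_mat n *\<^sub>v x)) $ i
    = (1 \<cdot>\<^sub>v (path_mat n *\<^sub>v x) + (- 1) \<cdot>\<^sub>v (path_mat n *\<^sub>v (?P *\<^sub>v x))) $ i"
    using i x d
    by (cases i) (auto simp add: coord_proj_mat_apply[OF Tx] coord_proj_mat_apply[OF x]
        path_mat_apply[OF Px] path_mat_apply[OF x] odd_points simp del: index_mult_mat_vec)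
qed (auto simp: path_mat_def coord_proj_mat_def)

lemma nonzero_spectrum_M_inv_tridiag:
  assumes n: "1 \<le> n"
  shows "spectrum (M_inv n * tridiag_mat n) - {0}
    = (\<lambda>\<sigma>. 4 / (4 - \<sigma>\<^sup>2)) ` spectrum (path_mat n)"
proof -
  let ?A = "tridiag_mat n" and ?T = "path_mat n"
  let ?C = "the (mat_inverse ?A)" and ?P = "coord_proj_mat n (F_points n)"
  \<comment> \<open>Listed in the order of the context assumptions, to discharge them all at
    once.\<close>
  note facts = tridiag_mat_carrier tridiag_mat_inverse(3)[OF n] coord_proj_mat_carrier
    path_mat_carrier transpose_path_mat tridiag_mat_inverse(1,2)[OF n] tridiag_mat_apply
    coord_proj_mat_idem coord_proj_path_bipartite
  have K: "M_inv n * ?A = ?P * ?C * ?P * ?A" by (simp add: M_inv_def Let_def)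
  have less4: "\<sigma>\<^sup>2 < 4" if "\<sigma> \<in> spectrum ?T" for \<sigma>
    using path_spectrum_bounds[OF that] cos_path_angle_1_less[OF n] abs_square_less_1[of "\<sigma> / 2"] by (simp add: power_divide)
  show ?thesis
  proof (intro equalityI subsetI)
    fix \<mu> assume "\<mu> \<in> spectrum (M_inv n * ?A) - {0}"
    then have "\<mu> \<in> spectrum (?P * ?C * ?P * ?A)" "\<mu> \<noteq> 0" by (auto simp: K)
    then show "\<mu> \<in> (\<lambda>\<sigma>. 4 / (4 - \<sigma>\<^sup>2)) ` spectrum ?T"
      using projected_product_nonzero_eigenvalue[OF facts] by (metis (no_types, lifting) imageI)
  next
    fix \<mu> assume "\<mu> \<in> (\<lambda>\<sigma>. 4 / (4 - \<sigma>\<^sup>2)) ` spectrum ?T"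
    \<comment> \<open>The converse needs an eigenvector that survives the projection, so the
      explicit sine modes are used rather than an arbitrary eigenvector.\<close>
    then obtain k where k: "k \<in> {1..n}" and \<mu>: "\<mu> = 4 / (4 - (2 * cos (path_angle n k))\<^sup>2)"
      unfolding spectrum_path_mat by auto
    have "2 * cos (path_angle n k) \<in> spectrum ?T" using k by (auto simp: spectrum_path_mat)
    then have lt: "(2 * cos (path_angle n k))\<^sup>2 < 4" by (rule less4)
    have "(?P *\<^sub>v path_eigenvec n k) $ 0 \<noteq> 0"
      using path_eigenvec_0_pos[OF k] n by (simp add: coord_proj_mat_apply F_points_def)
    then have "?P *\<^sub>v path_eigenvec n k \<noteq> 0\<^sub>v n" using n by auto
    with lt have "\<mu> \<in> spectrum (?P * ?C * ?P * ?A)"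
      unfolding \<mu>
      by (intro projected_product_eigenvalueI[OF facts path_eigenvec_carrier path_mat_eigenvec]) auto
    with lt show "\<mu> \<in> spectrum (M_inv n * ?A) - {0}" by (simp add: K \<mu>)
  qed
qed

section \<open>Extreme nonzero eigenvalues and the closed form\<close>

theorem mainTheorem4:
  fixes n :: nat
  assumes "n \<ge> 3" and "odd n"
  shows "effective_cond (M_inv n * tridiag_mat n)
    = (spectral_cond (tridiag_mat n) + 1)\<^sup>2 / (4 * spectral_cond (tridiag_mat n))"
proof -
  have n: "1 \<le> n" using assms(1) by simp
  let ?c = "cos (path_angle n 1)" and ?S = "spectrum (M_inv n * tridiag_mat n)"
  let ?g = "\<lambda>\<sigma> :: real. 4 / (4 - \<sigma>\<^sup>2)"
  \<comment> \<open>From \<open>n \<ge> 3\<close> the first angle is below \<open>pi / 2\<close>,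
    which makes \<open>?c\<close> positive.\<close>
  have b: "0 < path_angle n 1" "path_angle n 1 < pi / 2"
    using assms(1) by (auto simp: path_angle_def field_simps)
  have c: "0 < ?c" "?c < 1"
    using b cos_path_angle_1_less[OF n] by (auto intro!: cos_gt_zero)
  have c2: "?c\<^sup>2 < 1" using c by (simp add: power_less_one_iff)
  have "M_inv n * tridiag_mat n \<in> carrier_mat n n"
    unfolding M_inv_def Let_def
    by (intro mult_carrier_mat[of _ n n] coord_proj_mat_carrier tridiag_mat_carrier
        tridiag_mat_inverse(3)[OF n])
  then have fin: "finite ?S" by (rule card_finite_spectrum)
  note S = nonzero_spectrum_M_inv_tridiag[OF n]
  have sq: "\<sigma>\<^sup>2 \<le> 4 * ?c\<^sup>2" if "\<sigma> \<in> spectrum (path_mat n)" for \<sigma>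
    using path_spectrum_bounds[OF that] c abs_le_square_iff[of \<sigma> "2 * ?c"]
    by (simp add: power_mult_distrib)
  have "?g (2 * ?c) = 1 / (1 - ?c\<^sup>2)" using c2 by (simp add: power_mult_distrib field_simps)
  then have mem: "1 / (1 - ?c\<^sup>2) \<in> ?S"
    using S path_spectrum_extremes(1)[OF n] by (metis DiffD1 imageI)
  \<comment> \<open>\<open>Max\<close> ranges over the whole spectrum, so the value 0 is treated
    apart from the values of \<open>?g\<close>, which grow with
    \<open>\<sigma>\<^sup>2\<close>.\<close>
  have "\<mu> \<le> 1 / (1 - ?c\<^sup>2)" if "\<mu> \<in> ?S" for \<mu>
  proof (cases "\<mu> = 0")
    case False
    then have "\<mu> \<in> ?S - {0}" using that by simp
    then obtain \<sigma> where "\<mu> = ?g \<sigma>" "\<sigma> \<in> spectrum (path_mat n)"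
      unfolding S by (rule imageE)
    moreover from this(2) have "?g \<sigma> \<le> 4 / (4 * (1 - ?c\<^sup>2))"
      using sq[of \<sigma>] c2 by (intro divide_left_mono mult_pos_pos) auto
    moreover have "4 / (4 * (1 - ?c\<^sup>2)) = 1 / (1 - ?c\<^sup>2)"
      by (subst nonzero_divide_mult_cancel_left) simp_all
    ultimately show ?thesis by metis
  qed (use c2 in simp)
  then have Max: "Max ?S = 1 / (1 - ?c\<^sup>2)" using fin mem by (intro Max_eqI)
  \<comment> \<open>Oddness provides a middle mode \<open>k = m + 1\<close> with angle
    \<open>pi / 2\<close>, hence \<sigma> = 0 and \<open>?g 0 = 1\<close>.\<close>
  obtain m where m: "n = 2 * m + 1" using assms(2) by (rule oddE)
  have "path_angle n (Suc m) = pi / 2"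
    by (simp add: path_angle_def m field_simps)
  moreover have "2 * cos (path_angle n (Suc m)) \<in> spectrum (path_mat n)"
    unfolding spectrum_path_mat by (rule imageI) (simp add: m)
  ultimately have "0 \<in> spectrum (path_mat n)" by (metis cos_pi_half mult_zero_right)
  then have one: "1 \<in> ?S - {0}" unfolding S by (rule rev_image_eqI) simp
  have "1 \<le> \<mu>" if "\<mu> \<in> ?S - {0}" for \<mu>
  proof -
    from that obtain \<sigma> where "\<mu> = ?g \<sigma>" "\<sigma> \<in> spectrum (path_mat n)"
      unfolding S by (rule imageE)
    moreover from this(2) have "0 < 4 - \<sigma>\<^sup>2" using sq[of \<sigma>] c2 by simp
    ultimately show ?thesis by simp
  qed
  then have "Min (?S - {0}) = 1" using fin one by (intro Min_eqI) auto
  then have "effective_cond (M_inv n * tridiag_mat n) = 1 / (1 - ?c\<^sup>2)"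
    by (simp add: effective_cond_def Max)
  moreover have "((1 + ?c) / (1 - ?c) + 1)\<^sup>2 / (4 * ((1 + ?c) / (1 - ?c))) = 1 / (1 - ?c\<^sup>2)"
  proof -
    \<comment> \<open>Used with \<open>d = 1 - ?c\<close> and \<open>e = 1 + ?c\<close>: the
      condition number is \<open>e / d\<close>, and \<open>d + e = 2\<close> turns it plus one into
      \<open>2 / d\<close>.\<close>
    have frac: "(2 / d)\<^sup>2 / (4 * (e / d)) = 1 / (d * e)" if "d \<noteq> 0" "e \<noteq> 0" for d e :: real
      using that by (simp add: power2_eq_square divide_simps)
    have "(1 + ?c) / (1 - ?c) + 1 = 2 / (1 - ?c)" using c by (simp add: field_simps)
    moreover have "1 - ?c\<^sup>2 = (1 - ?c) * (1 + ?c)" by (simp add: algebra_simps power2_eq_square)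
    ultimately show ?thesis using c frac[of "1 - ?c" "1 + ?c"] by (simp only:)
  qed
  ultimately show ?thesis by (simp add: spectral_cond_tridiag_mat[OF n])
qed

end
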